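(* Let $d\geq 2$. Assume $\mathcal{D}\subset\mathbb{R}^d$ is bounded and convex and contains the cube $[0,\epsilon)^d$ for some $\epsilon>0$. If $\alpha=(\alpha_1,\ldots,\alpha_d)\in\mathbb{R}^d$ is such that \[\sup_{T_1,\ldots,T_d\geq 1} G(\alpha,\mathcal{D}_T)=\infty,\] then \[\liminf_{n\to\infty} n\,\|n\alpha_1\|_{\mathbb{R}/\mathbb{Z}}\cdots\|n\alpha_d\|_{\mathbb{R}/\mathbb{Z}}=0.\]
   Context: For a bounded set $\mathcal{D}\subset\mathbb{R}^d$ and $\alpha\in\mathbb{R}^d$, let $S(\alpha,\mathcal{D})=\{m\cdot\alpha \bmod 1 \mid m\in\mathbb{Z}^d\cap\mathcal{D}\}\subset\mathbb{R}/\mathbb{Z}$, and let $G(\alpha,\mathcal{D})$ be the number of distinct lengths of the gaps between consecutive elements of $S(\alpha,\mathcal{D})$ on the circle $\mathbb{R}/\mathbb{Z}$. For $T=\operatorname{diag}(T_1,\ldots,T_d)$ with $T_i>0$, $\mathcal{D}_T=\{xT\mid x\in\mathcal{D}\}$ (with $x$ a row vector). $\|x\|_{\mathbb{R}/\mathbb{Z}}$ denotes the distance from $x$ to the nearest integer. *)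

theory Defs
  imports "HOL-Analysis.Analysis"
begin

text \<open>Points of the circle R/Z are represented by their representatives in [0,1) (via frac).\<close>

definition int_vec :: "real ^ 'n \<Rightarrow> bool" where
  "int_vec m \<longleftrightarrow> (\<forall>i. m $ i \<in> \<int>)"

definition Sset :: "real ^ 'n \<Rightarrow> (real ^ 'n) set \<Rightarrow> real set" where
  "Sset \<alpha> D = {frac (m \<bullet> \<alpha>) | m. int_vec m \<and> m \<in> D}"

text \<open>Length of the arc going forward (counterclockwise) from s to t on R/Z; a full turn if t = s.\<close>
definition circ_step :: "real \<Rightarrow> real \<Rightarrow> real" where
  "circ_step s t = (if frac (t - s) = 0 then 1 else frac (t - s))"

definition gap_after :: "real set \<Rightarrow> real \<Rightarrow> real" where
  "gap_after S s = Min {circ_step s t | t. t \<in> S}"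

definition num_gaps :: "real set \<Rightarrow> nat" where
  "num_gaps S = card (gap_after S ` S)"

definition G :: "real ^ 'n \<Rightarrow> (real ^ 'n) set \<Rightarrow> nat" where
  "G \<alpha> D = num_gaps (Sset \<alpha> D)"

definition scaleT :: "real ^ 'n \<Rightarrow> (real ^ 'n) set \<Rightarrow> (real ^ 'n) set" where
  "scaleT T D = {(\<chi> i. x $ i * T $ i) | x. x \<in> D}"

definition dist_Z :: "real \<Rightarrow> real" where
  "dist_Z x = \<bar>x - of_int (round x)\<bar>"

end

theory Submission
  imports Defs
begin

text \<open>
  If the lower limit is positive, then \<open>q \<Prod>\<^sub>i \<parallel>q \<alpha>\<^sub>i\<parallel> \<ge> c > 0\<close> for all \<open>q \<ge> 1\<close>. By transference the dual
  form is badly approximable as well: \<open>\<bar>k \<bullet> \<alpha> + n\<bar> \<Prod>\<^sub>i max 1 \<bar>k\<^sub>i\<bar> \<ge> c'\<close> for \<open>k \<noteq> 0\<close>. Put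
  \<open>N = \<Prod>\<^sub>i T\<^sub>i\<close>. The homogeneous bound implies an inhomogeneous one, so the multiples \<open>m \<bullet> \<alpha>\<close> with
  \<open>0 \<le> m\<^sub>i < \<epsilon> T\<^sub>i\<close> meet every arc of length \<open>C / N\<close> and all gaps are at most \<open>C / N\<close>. The difference
  of two distinct gap lengths is again of the form \<open>k \<bullet> \<alpha> + n\<close> with \<open>0 \<noteq> k = O(T)\<close>, hence at least
  a constant times \<open>1 / N\<close>. So the number of gap lengths is bounded independently of \<open>T\<close>.
\<close>

section \<open>Distance to the nearest integer, and a uniform bound from the lower limit\<close>

lemma dist_Z_le: "dist_Z x \<le> \<bar>x - of_int z\<bar>"
  unfolding dist_Z_def using round_diff_minimal[of x z] by simp

lemma dist_Z_nonneg: "0 \<le> dist_Z x"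
  by (simp add: dist_Z_def)

lemma dist_Z_mult_le: "dist_Z (real n * x) \<le> real n * dist_Z x"
proof -
  have "dist_Z (real n * x) \<le> \<bar>real n * x - of_int (int n * round x)\<bar>"
    by (rule dist_Z_le)
  also have "\<dots> = \<bar>real n * (x - of_int (round x))\<bar>"
    by (simp add: algebra_simps)
  also have "\<dots> = real n * dist_Z x"
    by (simp add: abs_mult dist_Z_def)
  finally show ?thesis .
qed

text \<open>A nonzero lower limit of nonnegative terms is positive, which bounds the terms only from
  some \<open>n0\<close> on. A smaller \<open>q\<close> is reached through a multiple
  \<open>M * q \<ge> n0\<close>: multiplying by \<open>M\<close> enlarges each distance at most
  \<open>M\<close> times, so the bound loses only a fixed power of \<open>M\<close>.\<close>

lemma liminf_pos_imp_bounded_below: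
  fixes a :: "'n::finite \<Rightarrow> real"
  assumes "liminf (\<lambda>n::nat. ereal (real n * (\<Prod>i\<in>UNIV. dist_Z (real n * a i)))) \<noteq> 0"
  obtains c where "c > 0" "\<And>q::nat. q \<ge> 1 \<Longrightarrow> c \<le> real q * (\<Prod>i\<in>UNIV. dist_Z (real q * a i))"
proof -
  define f where "f n = real n * (\<Prod>i\<in>UNIV. dist_Z (real n * a i))" for n :: nat
  have f0: "f n \<ge> 0" for n
    unfolding f_def by (intro mult_nonneg_nonneg prod_nonneg) (auto simp: dist_Z_nonneg)
  have "liminf (\<lambda>n. ereal (f n)) \<ge> 0"
    by (rule Liminf_bounded) (simp add: f0)
  then have "0 < liminf (\<lambda>n. ereal (f n))"
    using assms unfolding f_def by simp
  then obtain C where C: "0 < C" "\<forall>\<^sub>F n in sequentially. C < ereal (f n)"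
    by (metis less_LiminfD dense)
  then obtain c n0 where c: "c > 0" "\<And>n. n \<ge> n0 \<Longrightarrow> c < f n"
  proof -
    obtain c where c: "0 < ereal c" "ereal c < C" using C(1) ereal_dense2 by blast
    obtain n0 where "\<And>n. n \<ge> n0 \<Longrightarrow> C < ereal (f n)"
      using C(2) unfolding eventually_sequentially by blast
    then have "\<And>n. n \<ge> n0 \<Longrightarrow> c < f n"
      using c(2) by (metis less_ereal.simps(1) order_less_trans)
    then show ?thesis using c(1) by (intro that[of c n0]) auto
  qed
  define M where "M = Suc n0"
  have scale: "f (M * q) \<le> (real M * real M ^ CARD('n)) * f q" for q
  proof -
    have "(\<Prod>i\<in>UNIV. dist_Z (real (M * q) * a i)) \<le> (\<Prod>i\<in>UNIV. real M * dist_Z (real q * a i))"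
      using dist_Z_mult_le[of M "real q * a _"]
      by (intro prod_mono) (auto simp: dist_Z_nonneg mult.assoc)
    also have "\<dots> = real M ^ CARD('n) * (\<Prod>i\<in>UNIV. dist_Z (real q * a i))"
      by (simp add: prod.distrib)
    finally have "real (M*q) * (\<Prod>i\<in>UNIV. dist_Z (real (M * q) * a i))
       \<le> real (M*q) * (real M ^ CARD('n) * (\<Prod>i\<in>UNIV. dist_Z (real q * a i)))"
      by (rule mult_left_mono) simp
    then show ?thesis unfolding f_def by (simp add: mult_ac)
  qed
  have Mp: "real M * real M ^ CARD('n) > 0" by (simp add: M_def)
  show thesis
  proof
    show "c / (real M * real M ^ CARD('n)) > 0" using c(1) Mp by simp
    fix q :: nat assume q: "q \<ge> 1"
    have "M * q \<ge> M * 1" using q by (rule mult_le_mono2)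
    then have "n0 \<le> M * q" by (simp add: M_def)
    then have "c \<le> (real M * real M ^ CARD('n)) * f q" using c(2)[of "M*q"] scale[of q] by linarith
    then show "c / (real M * real M ^ CARD('n)) \<le> real q * (\<Prod>i\<in>UNIV. dist_Z (real q * a i))"
      using Mp unfolding f_def by (simp add: pos_divide_le_eq mult.commute)
  qed
qed

section \<open>Transference from simultaneous approximation to one linear form\<close>

text \<open>
  Suppose \<open>e = k \<bullet> a + n\<close> is tiny and \<open>k\<^sub>j \<noteq> 0\<close>. Dirichlet's box argument with cells of side
  \<open>1 / (T\<^sub>i P)\<close>, \<open>T\<^sub>i = max 1 \<bar>k\<^sub>i\<bar>\<close>, gains a factor \<open>P\<close>: the points \<open>q a\<close> mod 1 lie near the subtori
  \<open>k \<bullet> x \<in> \<int>\<close>, so in direction \<open>j\<close> the integer nearest to \<open>k \<bullet> x\<close> determines the cell and only \<open>O(T\<^sub>j)\<close>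
  of the \<open>T\<^sub>j P\<close> cells are hit.
\<close>
lemma transference:
  fixes a :: "'n::finite \<Rightarrow> real"
  assumes c: "c > 0" "\<And>q::nat. q \<ge> 1 \<Longrightarrow> c \<le> real q * (\<Prod>i\<in>UNIV. dist_Z (real q * a i))"
  obtains c' where "c' > 0" "\<And>(k::'n \<Rightarrow> int) (n::int). (\<exists>i. k i \<noteq> 0) \<Longrightarrow>
     c' \<le> \<bar>(\<Sum>i\<in>UNIV. k i * a i) + n\<bar> * (\<Prod>i\<in>UNIV. max 1 \<bar>real_of_int (k i)\<bar>)"
proof -
  define d where "d = CARD('n)"
  have d1: "d \<ge> 1" unfolding d_def by (simp add: Suc_leI)
  obtain P0 :: nat where P0: "9 * real d / c < real P0" using reals_Archimedean2 by blast
  \<comment> \<open>\<open>P0\<close> yields the final contradiction \<open>9 * d / P < c\<close>;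
    \<open>P \<ge> d\<close> keeps the total rounding error \<open>(d - 1) / P\<close> below
    1.\<close>
  define P where "P = max P0 d"
  have P: "P \<ge> 1" "P \<ge> d" "9 * real d / c < real P" using P0 d1 by (auto simp: P_def)
  have P9: "9 * real d / real P < c" using P c(1) by (simp add: field_simps)
  define c' where "c' = 1 / (9 * real P ^ d)"
  show thesis
  proof
    show "c' > 0" using P by (simp add: c'_def)
    fix k :: "'n \<Rightarrow> int" and n :: int
    assume "\<exists>i. k i \<noteq> 0"
    then obtain j where j: "k j \<noteq> 0" by blast
    define T where "T i = max 1 \<bar>k i\<bar>" for i
    define e where "e = (\<Sum>i\<in>UNIV. k i * a i) + n"
    define N where "N = (\<Prod>i\<in>UNIV. T i)"
    have T1: "T i \<ge> 1" and kT: "\<bar>k i\<bar> \<le> T i" for i by (auto simp: T_def)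
    have Tj: "T j = \<bar>k j\<bar>" using j by (auto simp: T_def)
    have N1: "N \<ge> 1" unfolding N_def by (rule prod_ge_1) (use T1 in auto)
    have Nreal: "(\<Prod>i\<in>UNIV. max 1 \<bar>real_of_int (k i)\<bar>) = real_of_int N"
      unfolding N_def T_def of_int_prod by (intro prod.cong) auto
    show "c' \<le> \<bar>(\<Sum>i\<in>UNIV. k i * a i) + n\<bar> * (\<Prod>i\<in>UNIV. max 1 \<bar>real_of_int (k i)\<bar>)"
    proof (rule ccontr)
      assume "\<not> ?thesis"
      then have small: "\<bar>e\<bar> * N < c'" unfolding Nreal e_def by simp
      \<comment> \<open>\<open>Q\<close> bounds the number of labels: at most \<open>9 * T j\<close>
        in direction \<open>j\<close>, and \<open>T i * P\<close> in each of the
        \<open>d - 1\<close> others. \<open>c'\<close> is chosen so that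
        \<open>Q * \<bar>e\<bar> \<le> 1 / P\<close>.\<close>
      define Q where "Q = nat (9 * N * int P ^ (d - 1))"
      have Qreal: "real Q = 9 * N * real P ^ (d - 1)" using N1 by (simp add: Q_def)
      have PP: "real P ^ d = real P * real P ^ (d - 1)"
        using d1 by (metis Suc_diff_le diff_Suc_1 power_Suc le_add_diff_inverse plus_1_eq_Suc)
      have Qe: "real Q * \<bar>e\<bar> \<le> 1 / P"
      proof -
        have "real Q * \<bar>e\<bar> = 9 * real P ^ (d - 1) * (\<bar>e\<bar> * N)" by (simp add: Qreal)
        also have "\<dots> \<le> 9 * real P ^ (d - 1) * c'" using small by (intro mult_left_mono) auto
        also have "\<dots> = 1 / P" using P(1) by (simp add: c'_def PP)
        finally show ?thesis .
      qed
      have qe: "\<bar>real q * e\<bar> \<le> 1 / P" if "q \<le> Q" for q :: nat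
      proof -
        have "\<bar>real q * e\<bar> = real q * \<bar>e\<bar>" by (simp add: abs_mult)
        also have "\<dots> \<le> real Q * \<bar>e\<bar>" using that by (intro mult_right_mono) auto
        finally show ?thesis using Qe by linarith
      qed
      have P1: "1 / real P \<le> 1" using P(1) by simp
      define x where "x q i = frac (real q * a i)" for q :: nat and i
      define w where "w i = real_of_int (T i) * real P" for i
      define cell where "cell q i = \<lfloor>x q i * w i\<rfloor>" for q :: nat and i
      \<comment> \<open>\<open>L q\<close> is the integer near \<open>k \<bullet> x q\<close>,
        differing from it by exactly \<open>q * e\<close>. This names the subtorus close to the
        point.\<close>
      define L where "L q = (\<Sum>i\<in>UNIV. k i * (- \<lfloor>real q * a i\<rfloor>)) - int q * n" for q :: nat
      define u where "u q = (\<Sum>i\<in>UNIV-{j}. k i * (cell q i / w i))" for q :: nat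
      \<comment> \<open>\<open>u q\<close> replaces the coordinates other than \<open>j\<close> by
        their cell corners, so \<open>L q - \<lfloor>u q\<rfloor>\<close> is
        \<open>k j * x q j\<close> up to a bounded error. As \<open>u q\<close> depends only on the
        cells off \<open>j\<close>, equal labels give equal \<open>u\<close> and then equal
        \<open>L\<close>.\<close>
      define lab where "lab q i = (if i = j then L q - \<lfloor>u q\<rfloor> else cell q i)" for q :: nat and i
      have x01: "0 \<le> x q i" "x q i < 1" for q i by (simp_all add: x_def frac_lt_1)
      have Lx: "real_of_int (L q) = (\<Sum>i\<in>UNIV. k i * x q i) - real q * e" for q
        unfolding L_def x_def e_def frac_def
        by (simp add: algebra_simps sum_subtractf sum_distrib_left sum_negf)
      have Lx': "real_of_int (L q) = k j * x q j + (\<Sum>i\<in>UNIV-{j}. k i * x q i) - real q * e" for q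
        unfolding Lx by (subst sum.remove[of UNIV j]) auto
      have TP: "w i > 0" for i using T1[of i] P(1) by (simp add: w_def)
      have cellx: "cell q i / w i \<le> x q i" "x q i < cell q i / w i + 1 / w i" for q i
      proof -
        have "cell q i \<le> x q i * w i" "x q i * w i < cell q i + 1"
          unfolding cell_def by linarith+
        then show "cell q i / w i \<le> x q i" "x q i < cell q i / w i + 1 / w i"
          using TP[of i] by (simp_all add: pos_divide_le_eq mult.assoc add_divide_distrib[symmetric] pos_less_divide_eq)
      qed
      have sum_small: "\<bar>\<Sum>i\<in>UNIV-{j}. k i * y i\<bar> \<le> real (d - 1) / P"
        if y: "\<And>i. \<bar>y i\<bar> \<le> 1 / w i" for y :: "'n \<Rightarrow> real"
      proof -
        have "\<bar>\<Sum>i\<in>UNIV-{j}. k i * y i\<bar> \<le> (\<Sum>i\<in>UNIV-{j}. \<bar>k i * y i\<bar>)" by (rule sum_abs)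
        also have "\<dots> \<le> (\<Sum>i\<in>UNIV-{j}. 1 / P)"
        proof (rule sum_mono)
          fix i
          have "\<bar>k i * y i\<bar> \<le> T i * (1 / w i)"
            unfolding abs_mult using y[of i] kT[of i] T1[of i] by (intro mult_mono) auto
          also have "\<dots> = 1 / P" using T1[of i] by (simp add: w_def)
          finally show "\<bar>k i * y i\<bar> \<le> 1 / P" .
        qed
        also have "\<dots> = real (d - 1) / P" by (simp add: d_def)
        finally show ?thesis .
      qed
      \<comment> \<open>The 3 collects three errors of at most 1 each: from the corners in
        \<open>u q\<close>, from \<open>q * e\<close> and from the floor. The interval has
        \<open>2 * T j + 7 \<le> 9 * T j\<close> elements.\<close>
      define A where "A i = (if i = j then {- (T j + 3)..T j + 3} else {0..<T i * int P})" for i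
      have labA: "lab q \<in> PiE UNIV A" if q: "q \<in> {0..Q}" for q
      proof -
        have "lab q i \<in> A i" for i
        proof (cases "i = j")
          case False
          have "x q i * w i < 1 * w i" using x01[of q i] TP[of i]
            by (intro mult_strict_right_mono) auto
          then have "cell q i < T i * int P" unfolding cell_def floor_less_iff by (simp add: w_def)
          moreover have "cell q i \<ge> 0" unfolding cell_def using x01[of q i] TP[of i] by simp
          ultimately show ?thesis using False by (simp add: lab_def A_def)
        next
          case True
          have "\<bar>\<Sum>i\<in>UNIV-{j}. k i * (x q i - cell q i / w i)\<bar> \<le> real (d - 1) / P"
          proof (rule sum_small)
            show "\<bar>x q i - cell q i / w i\<bar> \<le> 1 / w i" for i
              using cellx[where q=q and i=i] by linarith
          qed
          also have "\<dots> \<le> 1" using P d1 by simp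
          finally have 1: "\<bar>(\<Sum>i\<in>UNIV-{j}. k i * x q i) - u q\<bar> \<le> 1"
            unfolding u_def by (simp add: right_diff_distrib sum_subtractf)
          have 2: "\<bar>k j * x q j\<bar> \<le> T j"
          proof -
            have "\<bar>k j * x q j\<bar> \<le> real_of_int (T j) * 1"
              unfolding abs_mult using x01[of q j] Tj by (intro mult_mono) auto
            then show ?thesis by simp
          qed
          have 3: "\<bar>real q * e\<bar> \<le> 1" using qe[of q] P1 q by auto
          have 4: "u q - 1 < \<lfloor>u q\<rfloor>" "\<lfloor>u q\<rfloor> \<le> u q" by linarith+
          have "\<bar>real_of_int (L q - \<lfloor>u q\<rfloor>)\<bar> \<le> real_of_int (T j + 3)"
            using 1 2 3 4 Lx'[of q] by (simp only: of_int_diff of_int_add of_int_numeral abs_le_iff) linarith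
          then have "\<bar>L q - \<lfloor>u q\<rfloor>\<bar> \<le> T j + 3" by (metis of_int_abs of_int_le_iff)
          then show ?thesis using True by (auto simp: lab_def A_def)
        qed
        then show ?thesis by auto
      qed
      have finA: "finite (PiE UNIV A)" by (rule finite_PiE) (auto simp: A_def)
      have cardA: "card (PiE UNIV A) \<le> Q"
      proof -
        have "int (card (A j)) \<le> 9 * T j" using T1[of j] by (simp add: A_def)
        moreover have TP0: "0 \<le> T i * int P" for i using T1[of i] by simp
        moreover have "(\<Prod>i\<in>UNIV-{j}. int (card (A i))) = (\<Prod>i\<in>UNIV-{j}. T i * int P)"
          using TP0 by (intro prod.cong) (auto simp: A_def)
        ultimately have "int (card (A j)) * (\<Prod>i\<in>UNIV-{j}. int (card (A i)))
           \<le> 9 * T j * (\<Prod>i\<in>UNIV-{j}. T i * int P)"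
          by (simp only:) (intro mult_right_mono prod_nonneg, auto)
        also have "\<dots> = 9 * (T j * (\<Prod>i\<in>UNIV-{j}. T i)) * int P ^ (d - 1)"
          by (simp add: prod.distrib d_def)
        also have "T j * (\<Prod>i\<in>UNIV-{j}. T i) = N"
          unfolding N_def by (simp add: prod.remove[of UNIV j T])
        also have "int (card (A j)) * (\<Prod>i\<in>UNIV-{j}. int (card (A i))) = int (card (PiE UNIV A))"
          by (simp add: card_PiE prod.remove[of UNIV j "\<lambda>i. int (card (A i))"])
        finally show ?thesis by (simp add: Q_def)
      qed
      have "\<not> inj_on lab {0..Q}"
      proof
        assume "inj_on lab {0..Q}"
        then have "card {0..Q} \<le> card (PiE UNIV A)"
          using labA finA by (intro card_inj_on_le) blast+
        then show False using cardA by simp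
      qed
      then obtain q q' where q: "q < q'" "q' \<le> Q" and lab: "lab q = lab q'"
        unfolding inj_on_def by (metis atLeastAtMost_iff linorder_neqE_nat)
      have cells: "cell q i = cell q' i" if "i \<noteq> j" for i
        using fun_cong[OF lab, of i] that by (simp add: lab_def)
      then have "u q = u q'" unfolding u_def by (intro sum.cong) auto
      then have LL: "L q = L q'" using fun_cong[OF lab, of j] by (simp add: lab_def)
      have close: "\<bar>x q' i - x q i\<bar> \<le> 1 / w i" if "i \<noteq> j" for i
        using cellx[where q=q and i=i] cellx[where q=q' and i=i]
        unfolding cells[OF that] by linarith
      \<comment> \<open>Closeness is known only off \<open>j\<close>, while \<open>sum_small\<close>
        asks for it at every index; hence the value 0 at \<open>j\<close>.\<close>
      define y where "y i = (if i = j then 0 else x q' i - x q i)" for i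
      have "\<bar>\<Sum>i\<in>UNIV-{j}. k i * y i\<bar> \<le> real (d - 1) / P"
        by (rule sum_small) (use close TP in \<open>auto simp: y_def less_imp_le\<close>)
      also have "(\<Sum>i\<in>UNIV-{j}. k i * y i) = (\<Sum>i\<in>UNIV-{j}. k i * (x q' i - x q i))"
        by (intro sum.cong) (auto simp: y_def)
      also have "\<dots> = (\<Sum>i\<in>UNIV-{j}. k i * x q' i) - (\<Sum>i\<in>UNIV-{j}. k i * x q i)"
        by (simp add: right_diff_distrib sum_subtractf)
      finally have s: "\<bar>(\<Sum>i\<in>UNIV-{j}. k i * x q' i) - (\<Sum>i\<in>UNIV-{j}. k i * x q i)\<bar> \<le> real (d - 1) / P" .
      \<comment> \<open>Since \<open>L q = L q'\<close>, the change of \<open>k j * x j\<close> is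
        balanced by the other coordinates and by \<open>(q' - q) * e\<close>. Division by
        \<open>\<bar>k j\<bar> = T j\<close> then gives closeness in direction \<open>j\<close> too,
        weaker by a factor \<open>d\<close>.\<close>
      have "\<bar>k j * (x q' j - x q j)\<bar> \<le> real (d - 1) / P + 1 / P"
      proof -
        have "\<bar>real (q' - q) * e\<bar> \<le> 1 / P" using qe[of "q' - q"] q by simp
        moreover have "real (q' - q) * e = real q' * e - real q * e"
          using q by (simp add: of_nat_diff algebra_simps)
        ultimately have "\<bar>real q' * e - real q * e\<bar> \<le> 1 / P" by simp
        moreover have "k j * (x q' j - x q j) = k j * x q' j - k j * x q j"
          by (simp add: algebra_simps)
        ultimately show ?thesis using s Lx'[of q] Lx'[of q'] LL by linarith
      qed
      also have "\<dots> = real d / P" using d1 by (simp add: add_divide_distrib[symmetric] of_nat_diff)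
      finally have closej: "\<bar>x q' j - x q j\<bar> \<le> real d / w j"
        using TP[of j] P(1) T1[of j]
        by (simp add: abs_mult w_def Tj pos_le_divide_eq mult_ac)
      define r where "r = q' - q"
      have r: "r \<ge> 1" "r \<le> Q" using q by (auto simp: r_def)
      have dist: "dist_Z (real r * a i) \<le> \<bar>x q' i - x q i\<bar>" for i
      proof -
        have "real r * a i - of_int (\<lfloor>real q' * a i\<rfloor> - \<lfloor>real q * a i\<rfloor>) = x q' i - x q i"
          using q by (simp add: r_def x_def frac_def of_nat_diff algebra_simps)
        then show ?thesis using dist_Z_le[of "real r * a i" "\<lfloor>real q' * a i\<rfloor> - \<lfloor>real q * a i\<rfloor>"] by simp
      qed
      have "(\<Prod>i\<in>UNIV. dist_Z (real r * a i)) \<le> (\<Prod>i\<in>UNIV. (if i = j then real d else 1) * (1 / w i))"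
      proof (rule prod_mono, intro conjI dist_Z_nonneg)
        fix i
        show "dist_Z (real r * a i) \<le> (if i = j then real d else 1) * (1 / w i)"
          using dist[of i] close[of i] closej by (cases "i = j") auto
      qed
      also have "\<dots> = real d * (1 / (N * real P ^ d))"
        by (simp add: prod.distrib prod_dividef N_def d_def w_def)
      finally have "real r * (\<Prod>i\<in>UNIV. dist_Z (real r * a i)) \<le> real Q * (real d * (1 / (N * real P ^ d)))"
        using r by (intro mult_mono prod_nonneg) (auto simp: dist_Z_nonneg)
      also have "\<dots> = 9 * real d / P" using N1 P(1) by (simp add: Qreal PP)
      also have "\<dots> < c" by (rule P9)
      finally show False using c(2)[OF r(1)] by linarith
    qed
  qed
qed

section \<open>Inhomogeneous approximation with bounded coefficients\<close>

text \<open>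
  The box principle is applied to the points \<open>r \<theta> / h! + m \<bullet> a\<close> with \<open>0 \<le> r \<le> h\<close>, of which there are more
  than arcs. The homogeneous bound forces a collision to have \<open>0 < \<bar>r - r'\<bar> \<le> h\<close>; since this divides
  \<open>h!\<close>, a multiple of the resulting relation approximates \<open>\<theta>\<close> itself.
\<close>
lemma inhomogeneous_covering:
  fixes a :: "'n::finite \<Rightarrow> real"
  assumes c: "c > 0" "\<And>(k::'n \<Rightarrow> int) (n::int). (\<exists>i. k i \<noteq> 0) \<Longrightarrow>
     c \<le> \<bar>(\<Sum>i\<in>UNIV. k i * a i) + n\<bar> * (\<Prod>i\<in>UNIV. max 1 \<bar>real_of_int (k i)\<bar>)"
  obtains H :: nat where "H \<ge> 1"
    "\<And>(S :: 'n \<Rightarrow> nat) (\<theta> :: real). (\<And>i. S i \<ge> 1) \<Longrightarrow>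
      \<exists>(m :: 'n \<Rightarrow> int) (n :: int). (\<forall>i. \<bar>m i\<bar> \<le> int H * (int (S i) - 1)) \<and>
        \<bar>(\<Sum>i\<in>UNIV. m i * a i) + n - \<theta>\<bar> \<le> real H / (\<Prod>i\<in>UNIV. real (S i))"
proof -
  define h where "h = nat \<lceil>1 / c\<rceil>"
  have hc: "1 / c \<le> real h" unfolding h_def by (simp add: of_nat_ceiling)
  have h1: "h \<ge> 1" using hc c(1) by (metis One_nat_def Suc_leI divide_pos_pos gr0I not_le of_nat_0 zero_less_one)
  define H :: nat where "H = fact h"
  show thesis
  proof
    show H1: "H \<ge> 1" by (simp add: H_def)
    fix S :: "'n \<Rightarrow> nat" and \<theta> :: real
    assume S1: "\<And>i. S i \<ge> 1"
    define W where "W = (\<Prod>i\<in>UNIV. S i)"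
    have W1: "W \<ge> 1" unfolding W_def by (rule prod_ge_1) (rule S1)
    have Wr: "(\<Prod>i\<in>UNIV. real (S i)) = real W" by (simp add: W_def)
    \<comment> \<open>There are \<open>h * W\<close> arcs for \<open>(h + 1) * W\<close>
      points.\<close>
    define Q where "Q = h * W"
    have Q1: "Q \<ge> 1" using h1 W1 by (simp add: Q_def)
    define \<gamma> where "\<gamma> = \<theta> / H"
    define v where "v p = real (fst p) * \<gamma> + (\<Sum>i\<in>UNIV. snd p i * a i)" for p :: "nat \<times> ('n \<Rightarrow> int)"
    define B where "B = {0..h} \<times> PiE UNIV (\<lambda>i. {0..<int (S i)})"
    have cardB: "card B = (h + 1) * W"
      unfolding B_def W_def by (simp add: card_cartesian_product card_PiE)
    have finB: "finite B" unfolding B_def by (intro finite_cartesian_product finite_PiE) auto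
    define \<phi> where "\<phi> p = \<lfloor>frac (v p) * Q\<rfloor>" for p
    have "\<phi> ` B \<subseteq> {0..<int Q}"
    proof safe
      fix p
      have "frac (v p) * Q < 1 * real Q"
        using Q1 frac_lt_1 by (intro mult_strict_right_mono) auto
      then show "\<phi> p \<in> {0..<int Q}" by (simp add: \<phi>_def floor_less_iff)
    qed
    have "\<not> inj_on \<phi> B"
    proof
      assume "inj_on \<phi> B"
      then have "card B \<le> card {0..<int Q}"
        using \<open>\<phi> ` B \<subseteq> _\<close> by (intro card_inj_on_le) auto
      then have "(h + 1) * W \<le> h * W" by (simp only: cardB Q_def card_atLeastLessThan_int diff_zero nat_int)
      then show False using W1 by simp
    qed
    then obtain p p' where p: "p \<in> B" "p' \<in> B" "p \<noteq> p'" "\<phi> p = \<phi> p'"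
      unfolding inj_on_def by blast
    define t where "t = int (fst p) - int (fst p')"
    define k where "k i = snd p i - snd p' i" for i
    define n where "n = \<lfloor>v p'\<rfloor> - \<lfloor>v p\<rfloor>"
    have "\<bar>frac (v p) * Q - frac (v p') * Q\<bar> < 1"
      using p(4) unfolding \<phi>_def by linarith
    then have "\<bar>frac (v p) - frac (v p')\<bar> * Q < 1"
      by (simp add: left_diff_distrib[symmetric] abs_mult)
    then have "\<bar>frac (v p) - frac (v p')\<bar> < 1 / Q" using Q1 by (simp add: field_simps)
    moreover have "frac (v p) - frac (v p') = t * \<gamma> + (\<Sum>i\<in>UNIV. k i * a i) + n"
      by (simp add: frac_def v_def t_def k_def n_def left_diff_distrib sum_subtractf)
    ultimately have near: "\<bar>t * \<gamma> + (\<Sum>i\<in>UNIV. k i * a i) + n\<bar> < 1 / Q" by simp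
    have kS: "\<bar>k i\<bar> \<le> int (S i) - 1" for i
    proof -
      have "snd p i \<in> {0..<int (S i)}" "snd p' i \<in> {0..<int (S i)}"
        using p(1,2) unfolding B_def by (auto simp: PiE_iff)
      then show ?thesis by (auto simp: k_def)
    qed
    \<comment> \<open>If \<open>t = 0\<close>, the form is smaller than \<open>1 / Q\<close> with
      coefficient product at most \<open>W\<close>, so the homogeneous bound would give
      \<open>c < W / Q = 1 / h\<close>, against the choice of \<open>h\<close>.\<close>
    have t0: "t \<noteq> 0"
    proof
      assume t: "t = 0"
      then have "snd p \<noteq> snd p'" using p(3) by (auto simp: t_def prod_eq_iff)
      then have "\<exists>i. k i \<noteq> 0" by (auto simp: k_def fun_eq_iff)
      then have "c \<le> \<bar>(\<Sum>i\<in>UNIV. k i * a i) + n\<bar> * (\<Prod>i\<in>UNIV. max 1 \<bar>real_of_int (k i)\<bar>)"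
        by (rule c(2))
      also have "\<dots> \<le> \<bar>(\<Sum>i\<in>UNIV. k i * a i) + n\<bar> * W"
      proof (rule mult_left_mono)
        have "max 1 \<bar>real_of_int (k i)\<bar> \<le> real (S i)" for i
          using S1[of i] kS[of i] by linarith
        then show "(\<Prod>i\<in>UNIV. max 1 \<bar>real_of_int (k i)\<bar>) \<le> real W"
          unfolding Wr[symmetric] by (intro prod_mono) auto
      qed simp
      also have "\<dots> < 1 / Q * W" using near t W1 by (intro mult_strict_right_mono) auto
      also have "\<dots> = 1 / h" using W1 by (simp add: Q_def)
      also have "\<dots> \<le> c" using hc c(1) h1 by (simp add: field_simps)
      finally show False by simp
    qed
    have "\<bar>t\<bar> \<le> int h" using p(1,2) by (auto simp: B_def t_def)
    then have "nat \<bar>t\<bar> dvd H" unfolding H_def using t0 by (intro dvd_fact) auto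
    then have "t dvd int H" by (simp add: nat_abs_dvd_iff)
    \<comment> \<open>Multiplying the relation by \<open>-f\<close> turns
      \<open>t * \<gamma>\<close> into \<open>-\<theta>\<close>. Both coefficients and error grow by
      \<open>\<bar>f\<bar> \<le> H\<close> at most.\<close>
    then obtain f where f: "int H = t * f" by blast
    have fH: "\<bar>f\<bar> \<le> int H"
      by (metis f H1 abs_ge_self abs_of_nat dvd_imp_le_int dvd_triv_right not_one_le_zero of_nat_eq_0_iff)
    show "\<exists>(m :: 'n \<Rightarrow> int) (n :: int). (\<forall>i. \<bar>m i\<bar> \<le> int H * (int (S i) - 1)) \<and>
        \<bar>(\<Sum>i\<in>UNIV. m i * a i) + n - \<theta>\<bar> \<le> real H / (\<Prod>i\<in>UNIV. real (S i))"
    proof (intro exI conjI allI)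
      show "\<bar>- f * k i\<bar> \<le> int H * (int (S i) - 1)" for i
        unfolding abs_mult abs_minus_cancel using fH kS by (intro mult_mono) auto
      have \<theta>: "\<theta> = f * (t * \<gamma>)"
      proof -
        have "real H = of_int t * of_int f" using f by (metis of_int_mult of_int_of_nat_eq)
        then show ?thesis using H1 unfolding \<gamma>_def by (metis (no_types) less_one linorder_not_less mult.assoc mult.commute nonzero_mult_div_cancel_left of_nat_eq_0_iff times_divide_eq_right)
      qed
      have "(\<Sum>i\<in>UNIV. (- f * k i) * a i) + (- f * n) - \<theta>
          = - f * (t * \<gamma> + (\<Sum>i\<in>UNIV. k i * a i) + n)"
        by (simp add: \<theta> algebra_simps sum_distrib_left sum_negf)
      then have "\<bar>(\<Sum>i\<in>UNIV. (- f * k i) * a i) + (- f * n) - \<theta>\<bar>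
          = \<bar>f\<bar> * \<bar>t * \<gamma> + (\<Sum>i\<in>UNIV. k i * a i) + n\<bar>"
        by (simp add: abs_mult)
      also have "\<dots> \<le> real H * (1 / Q)" using near fH by (intro mult_mono) auto
      also have "\<dots> \<le> real H * (1 / W)"
        using h1 W1 by (intro mult_left_mono divide_left_mono) (auto simp: Q_def)
      finally show "\<bar>(\<Sum>i\<in>UNIV. (- f * k i) * a i) + (- f * n) - \<theta>\<bar> \<le> real H / (\<Prod>i\<in>UNIV. real (S i))"
        by (simp add: Wr)
    qed
  qed
qed

section \<open>Counting separated reals, and finiteness of bounded sets of integer vectors\<close>

text \<open>Two points in the same cell of length \<open>\<sigma>\<close> would be closer than
  \<open>\<sigma>\<close>, so the cell index is injective on \<open>A\<close>.\<close>

lemma card_separated_le: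
  fixes A :: "real set"
  assumes "\<sigma> > 0" "C \<ge> 0" and A: "A \<subseteq> {0..C * \<sigma>}"
    and sep: "\<And>x y. x \<in> A \<Longrightarrow> y \<in> A \<Longrightarrow> x \<noteq> y \<Longrightarrow> \<sigma> \<le> \<bar>x - y\<bar>"
  shows "finite A \<and> card A \<le> nat \<lfloor>C\<rfloor> + 1"
proof -
  have inj: "inj_on (\<lambda>x. \<lfloor>x / \<sigma>\<rfloor>) A"
  proof (rule inj_onI, rule ccontr)
    fix x y assume xy: "x \<in> A" "y \<in> A" "\<lfloor>x / \<sigma>\<rfloor> = \<lfloor>y / \<sigma>\<rfloor>" "x \<noteq> y"
    have "\<bar>x / \<sigma> - y / \<sigma>\<bar> < 1" using xy(3) by linarith
    moreover have "\<bar>x / \<sigma> - y / \<sigma>\<bar> = \<bar>x - y\<bar> / \<sigma>" using assms(1) by (simp add: diff_divide_distrib[symmetric])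
    ultimately show False using sep[OF xy(1,2,4)] assms(1) by (simp add: field_simps)
  qed
  have sub: "(\<lambda>x. \<lfloor>x / \<sigma>\<rfloor>) ` A \<subseteq> {0..\<lfloor>C\<rfloor>}"
  proof safe
    fix x assume "x \<in> A"
    then have "0 \<le> x / \<sigma>" "x / \<sigma> \<le> C" using A assms(1) by (auto simp: field_simps)
    then show "\<lfloor>x / \<sigma>\<rfloor> \<in> {0..\<lfloor>C\<rfloor>}" by (simp add: floor_mono)
  qed
  have "finite A" using inj sub by (rule inj_on_finite) simp
  moreover have "card A \<le> card {0..\<lfloor>C\<rfloor>}" using inj sub by (intro card_inj_on_le) auto
  ultimately show ?thesis using assms(2) by (simp add: nat_add_distrib)
qed

lemma int_vecE:
  fixes m :: "real ^ 'n"
  assumes "int_vec m"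
  obtains k :: "'n \<Rightarrow> int" where "\<And>i. m $ i = k i"
proof -
  have "\<forall>i. \<exists>z::int. m $ i = z" using assms by (auto simp: int_vec_def elim: Ints_cases)
  then show thesis using that by metis
qed

lemma finite_int_vec_bounded:
  fixes X :: "(real ^ 'n) set"
  assumes "\<And>x i. x \<in> X \<Longrightarrow> \<bar>x $ i\<bar> \<le> R i"
  shows "finite {m. int_vec m \<and> m \<in> X}"
proof (rule finite_subset)
  show "finite ((\<lambda>k. \<chi> i. real_of_int (k i)) ` PiE UNIV (\<lambda>i. {-\<lceil>R i\<rceil>..\<lceil>R i\<rceil>}))"
    by (intro finite_imageI finite_PiE) auto
  show "{m. int_vec m \<and> m \<in> X} \<subseteq> (\<lambda>k. \<chi> i. real_of_int (k i)) ` PiE UNIV (\<lambda>i. {-\<lceil>R i\<rceil>..\<lceil>R i\<rceil>})"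
  proof safe
    fix m assume m: "int_vec m" "m \<in> X"
    obtain k :: "'n \<Rightarrow> int" where k: "\<And>i. m $ i = k i" by (rule int_vecE[OF m(1)]) blast
    have "k i \<in> {-\<lceil>R i\<rceil>..\<lceil>R i\<rceil>}" for i
      using assms[OF m(2), of i] by (simp add: k) linarith
    moreover have "m = (\<chi> i. real_of_int (k i))" by (simp add: vec_eq_iff k)
    ultimately show "m \<in> (\<lambda>k. \<chi> i. real_of_int (k i)) ` PiE UNIV (\<lambda>i. {-\<lceil>R i\<rceil>..\<lceil>R i\<rceil>})"
      by blast
  qed
qed

lemma circ_step_le_1: "circ_step s t \<le> 1"
  by (simp add: circ_step_def frac_lt_1 less_imp_le)

section \<open>Gap lengths: upper bound, separation and count, uniformly in \<open>T\<close>\<close>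

lemma G_bounded:
  fixes D :: "(real ^ 'n) set" and \<alpha> :: "real ^ 'n" and \<epsilon> :: real
  assumes c: "c > 0" "\<And>(k::'n \<Rightarrow> int) (n::int). (\<exists>i. k i \<noteq> 0) \<Longrightarrow>
     c \<le> \<bar>(\<Sum>i\<in>UNIV. k i * \<alpha> $ i) + n\<bar> * (\<Prod>i\<in>UNIV. max 1 \<bar>real_of_int (k i)\<bar>)"
    and D: "bounded D" and \<epsilon>: "\<epsilon> > 0" "{x. \<forall>i. 0 \<le> x $ i \<and> x $ i < \<epsilon>} \<subseteq> D"
  shows "\<exists>K. \<forall>T. (\<forall>i. T $ i \<ge> 1) \<longrightarrow> G \<alpha> (scaleT T D) \<le> K"
proof -
  obtain H :: nat where H1: "H \<ge> 1" and H:
    "\<And>(S :: 'n \<Rightarrow> nat) (\<theta> :: real). (\<And>i. S i \<ge> 1) \<Longrightarrow>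
      \<exists>(m :: 'n \<Rightarrow> int) (n :: int). (\<forall>i. \<bar>m i\<bar> \<le> int H * (int (S i) - 1)) \<and>
        \<bar>(\<Sum>i\<in>UNIV. m i * \<alpha> $ i) + n - \<theta>\<bar> \<le> real H / (\<Prod>i\<in>UNIV. real (S i))"
    by (rule inhomogeneous_covering[of c "\<lambda>i. \<alpha> $ i", OF c]) blast+
  obtain b where b: "b \<ge> 1" "\<And>x i. x \<in> D \<Longrightarrow> \<bar>x $ i\<bar> \<le> b"
  proof -
    obtain b where "\<And>x. x \<in> D \<Longrightarrow> norm x \<le> b" using D by (auto simp: bounded_iff)
    then show thesis using that[of "max b 1"] component_le_norm_cart by (meson max.cobounded1 max.cobounded2 order_trans)
  qed
  define d where "d = CARD('n)"
  define C0 where "C0 = 3 * real H * (2 * real H / \<epsilon>) ^ d"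
  define C where "C = C0 * (4 * b) ^ d / c"
  have C0: "C0 > 0" using H1 \<epsilon>(1) by (simp add: C0_def)
  have C: "C > 0" using C0 b(1) c(1) by (simp add: C_def)
  show ?thesis
  proof (intro exI allI impI)
    fix T :: "real ^ 'n" assume "\<forall>i. T $ i \<ge> 1"
    then have T1: "T $ i \<ge> 1" for i by blast
    have Tpos: "T $ i > 0" for i using T1[of i] by linarith
    define N where "N = (\<Prod>i\<in>UNIV. T $ i)"
    have N: "N > 0" unfolding N_def using Tpos by (simp add: prod_pos)
    define X where "X = scaleT T D"
    define S where "S = Sset \<alpha> X"
    have Xb: "\<bar>x $ i\<bar> \<le> b * T $ i" if "x \<in> X" for x i
    proof -
      obtain y where "y \<in> D" "x = (\<chi> i. y $ i * T $ i)" using \<open>x \<in> X\<close> by (auto simp: X_def scaleT_def)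
      then show ?thesis using b(2)[of y i] Tpos[of i] by (simp add: abs_mult)
    qed
    \<comment> \<open>Finiteness makes the \<open>Min\<close> in \<open>gap_after\<close> an
      attained minimum.\<close>
    have finS: "finite S"
    proof -
      have "S = (\<lambda>m. frac (m \<bullet> \<alpha>)) ` {m. int_vec m \<and> m \<in> X}" by (auto simp: S_def Sset_def)
      then show ?thesis using finite_int_vec_bounded[of X "\<lambda>i. b * T $ i"] Xb by simp
    qed
    have SE: "\<exists>(k::'n \<Rightarrow> int) (n::int). s = (\<Sum>i\<in>UNIV. k i * \<alpha> $ i) + n \<and> (\<forall>i. \<bar>real_of_int (k i)\<bar> \<le> b * T $ i)"
      if "s \<in> S" for s
    proof -
      obtain m where m: "s = frac (m \<bullet> \<alpha>)" "int_vec m" "m \<in> X" using \<open>s \<in> S\<close> by (auto simp: S_def Sset_def)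
      obtain k :: "'n \<Rightarrow> int" where k: "\<And>i. m $ i = k i" by (rule int_vecE[OF m(2)]) blast
      have "s = (\<Sum>i\<in>UNIV. k i * \<alpha> $ i) + of_int (- \<lfloor>m \<bullet> \<alpha>\<rfloor>)"
        by (simp add: m(1) frac_def inner_vec_def k)
      moreover have "\<bar>real_of_int (k i)\<bar> \<le> b * T $ i" for i using Xb[OF m(3), of i] by (simp add: k)
      ultimately show ?thesis by blast
    qed
    \<comment> \<open>\<open>\<rho>\<close> is the covering radius obtained below for the box sizes
      \<open>Z\<close>; \<open>C0\<close> is chosen so that
      \<open>3 * \<rho> = C0 / N\<close>.\<close>
    define \<rho> where "\<rho> = C0 / (3 * N)"
    have \<rho>: "\<rho> > 0" using C0 N by (simp add: \<rho>_def)
    have fin: "finite {circ_step s t |t. t \<in> S}" for s using finS by simp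
    have gap_le: "gap_after S s \<le> 3 * \<rho>" if "s \<in> S" for s
    proof -
      \<comment> \<open>The ceiling makes the product of the \<open>Z i\<close> at least a constant
        times \<open>N\<close>, while \<open>2 * H * (Z i - 1)\<close> stays strictly below
        \<open>\<epsilon> * T $ i\<close>, as the half-open cube requires.\<close>
      define Z where "Z i = nat \<lceil>\<epsilon> * T $ i / (2 * H)\<rceil>" for i
      have arg: "\<epsilon> * T $ i / (2 * H) > 0" for i using \<epsilon>(1) Tpos[of i] H1 by simp
      have Z1: "Z i \<ge> 1" for i using arg[of i] unfolding Z_def by linarith
      have Zge: "\<epsilon> * T $ i / (2 * H) \<le> real (Z i)" for i
        unfolding Z_def by (rule of_nat_ceiling)
      have "real (Z i) - 1 < \<epsilon> * T $ i / (2 * H)" for i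
        using arg[of i] unfolding Z_def by linarith
      then have Zlt: "2 * real H * (real (Z i) - 1) < \<epsilon> * T $ i" for i
        using H1 by (simp add: pos_less_divide_eq mult.commute)
      have "(\<Prod>i\<in>UNIV. \<epsilon> * T $ i / (2 * H)) \<le> (\<Prod>i\<in>UNIV. real (Z i))"
        using Zge arg by (intro prod_mono) (auto simp: less_imp_le)
      moreover have "(\<Prod>i\<in>UNIV. \<epsilon> * T $ i / (2 * H)) = (\<epsilon> / (2 * H)) ^ d * N"
        by (simp add: prod.distrib prod_dividef N_def d_def power_divide)
      ultimately have "real H / (\<Prod>i\<in>UNIV. real (Z i)) \<le> real H / ((\<epsilon> / (2 * H)) ^ d * N)"
        using \<epsilon>(1) H1 N Z1 by (intro divide_left_mono mult_pos_pos prod_pos) (auto intro: Suc_le_lessD)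
      also have "\<dots> = \<rho>" unfolding \<rho>_def C0_def by (simp add: power_divide)
      finally have \<rho>': "real H / (\<Prod>i\<in>UNIV. real (Z i)) \<le> \<rho>" .
      define M where "M i = int H * (int (Z i) - 1)" for i
      \<comment> \<open>Shifting by \<open>M\<close> moves the symmetric range of \<open>m\<close>
        into \<open>0..2 * M\<close>, inside the scaled cube; the target is corrected by
        \<open>M \<bullet> \<alpha>\<close>. Aiming at \<open>s + 2 * \<rho>\<close> with error
        \<open>\<rho>\<close> puts the point ahead of \<open>s\<close>, by at least
        \<open>\<rho>\<close> and at most \<open>3 * \<rho>\<close>.\<close>
      obtain m :: "'n \<Rightarrow> int" and n :: int where m: "\<And>i. \<bar>m i\<bar> \<le> M i"
        "\<bar>(\<Sum>i\<in>UNIV. m i * \<alpha> $ i) + n - (s + 2 * \<rho> - (\<Sum>i\<in>UNIV. M i * \<alpha> $ i))\<bar> \<le> \<rho>"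
        using H[of Z "s + 2 * \<rho> - (\<Sum>i\<in>UNIV. M i * \<alpha> $ i)"] Z1 \<rho>'
        unfolding M_def by (meson order_trans)
      define v :: "real ^ 'n" where "v = (\<chi> i. real_of_int (m i + M i))"
      have v\<alpha>: "v \<bullet> \<alpha> = (\<Sum>i\<in>UNIV. m i * \<alpha> $ i) + (\<Sum>i\<in>UNIV. M i * \<alpha> $ i)"
        by (simp add: v_def inner_vec_def distrib_right sum.distrib)
      have "v \<in> X"
      proof -
        define w :: "real ^ 'n" where "w = (\<chi> i. v $ i / T $ i)"
        have "0 \<le> w $ i \<and> w $ i < \<epsilon>" for i
        proof -
          have 1: "0 \<le> m i + M i" "m i + M i \<le> 2 * M i" using m(1)[of i] by linarith+
          have "real_of_int (m i + M i) \<le> real_of_int (2 * M i)" using 1(2) by (simp only: of_int_le_iff)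
          also have "\<dots> < \<epsilon> * T $ i" using Zlt[of i] by (simp add: M_def)
          finally have "v $ i < \<epsilon> * T $ i" by (simp add: v_def)
          moreover have "0 \<le> v $ i" using 1(1) unfolding v_def by (simp del: of_int_add)
          ultimately show ?thesis using Tpos[of i] by (simp add: w_def pos_divide_less_eq)
        qed
        then have "w \<in> D" using \<epsilon>(2) by auto
        moreover have "v = (\<chi> i. w $ i * T $ i)"
          using Tpos by (simp add: vec_eq_iff w_def less_imp_neq[symmetric])
        ultimately show ?thesis unfolding X_def scaleT_def by blast
      qed
      then have t: "frac (v \<bullet> \<alpha>) \<in> S"
        unfolding S_def Sset_def by (auto simp: v_def int_vec_def simp del: of_int_add)
      have "gap_after S s \<le> circ_step s (frac (v \<bullet> \<alpha>))"
        unfolding gap_after_def using t fin by (intro Min_le) auto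
      also have "\<dots> \<le> 3 * \<rho>"
      proof (cases "3 * \<rho> \<ge> 1")
        case True
        then show ?thesis using circ_step_le_1[of s "frac (v \<bullet> \<alpha>)"] by linarith
      next
        case False
        define z where "z = v \<bullet> \<alpha> + n - s"
        have z: "\<rho> \<le> z" "z \<le> 3 * \<rho>" using m(2) unfolding z_def v\<alpha> by linarith+
        have "frac (v \<bullet> \<alpha>) - s = z + of_int (- n - \<lfloor>v \<bullet> \<alpha>\<rfloor>)"
          by (simp add: z_def frac_def)
        then have "frac (frac (v \<bullet> \<alpha>) - s) = frac z"
          by (metis frac_add_of_int_right)
        also have "\<dots> = z" using z \<rho> False by (simp add: frac_eq)
        finally show ?thesis using z \<rho> by (simp add: circ_step_def)
      qed
      finally show ?thesis .
    qed
    define \<Gamma> where "\<Gamma> = gap_after S ` S"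
    \<comment> \<open>The length 1 is the full-turn value of \<open>circ_step\<close> and is set
      aside. Every other gap is a fractional part \<open>frac (t - s)\<close>, and subtracting two
      points doubles the coefficient bound to \<open>2 * b * T $ i\<close>.\<close>
    have gapE: "0 < g \<and> g < 1 \<and> (\<exists>(k::'n \<Rightarrow> int) (n::int). g = (\<Sum>i\<in>UNIV. k i * \<alpha> $ i) + n \<and>
        (\<forall>i. \<bar>real_of_int (k i)\<bar> \<le> 2 * b * T $ i))" if "g \<in> \<Gamma> - {1}" for g
    proof -
      obtain s where s: "s \<in> S" "g = gap_after S s" using \<open>g \<in> \<Gamma> - {1}\<close> by (auto simp: \<Gamma>_def)
      have "gap_after S s \<in> {circ_step s t |t. t \<in> S}"
        unfolding gap_after_def using s(1) fin by (intro Min_in) auto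
      then obtain t where t: "t \<in> S" "g = circ_step s t" using s(2) by auto
      then have g: "g = frac (t - s)" "g \<noteq> 0" using \<open>g \<in> \<Gamma> - {1}\<close> by (auto simp: circ_step_def split: if_splits)
      obtain k n where k: "s = (\<Sum>i\<in>UNIV. k i * \<alpha> $ i) + of_int n" "\<And>i. \<bar>real_of_int (k i)\<bar> \<le> b * T $ i"
        using SE[OF s(1)] by blast
      obtain l r where l: "t = (\<Sum>i\<in>UNIV. l i * \<alpha> $ i) + of_int r" "\<And>i. \<bar>real_of_int (l i)\<bar> \<le> b * T $ i"
        using SE[OF t(1)] by blast
      define p where "p = (\<lambda>i. l i - k i)"
      have "g = (\<Sum>i\<in>UNIV. (l i - k i) * \<alpha> $ i) + of_int (r - n - \<lfloor>t - s\<rfloor>)"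
        unfolding g frac_def by (simp add: k(1) l(1) left_diff_distrib sum_subtractf)
      moreover have "\<bar>real_of_int (l i - k i)\<bar> \<le> 2 * b * T $ i" for i
        using k(2)[of i] l(2)[of i] unfolding of_int_diff by linarith
      moreover have "0 < g" using g frac_ge_0[of "t - s"] by linarith
      moreover have "g < 1" using g(1) frac_lt_1[of "t - s"] by linarith
      ultimately have "\<exists>n::int. g = (\<Sum>i\<in>UNIV. real_of_int (p i) * \<alpha> $ i) + n \<and> (\<forall>i. \<bar>real_of_int (p i)\<bar> \<le> 2 * b * T $ i)" "0 < g" "g < 1"
        unfolding p_def by blast+
      then show ?thesis by blast
    qed
    \<comment> \<open>Differences of two gap lengths have coefficients up to
      \<open>4 * b * T $ i\<close>, whose product is \<open>(4 * b) ^ d * N\<close>. Thus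
      \<open>\<sigma>\<close> and \<open>\<rho>\<close> both scale like \<open>1 / N\<close>, and
      their ratio, hence \<open>C\<close>, is free of \<open>T\<close>.\<close>
    define \<sigma> where "\<sigma> = c / ((4 * b) ^ d * N)"
    have \<sigma>: "\<sigma> > 0" using c(1) b(1) N by (simp add: \<sigma>_def)
    have C\<sigma>: "C * \<sigma> = 3 * \<rho>" using c(1) b(1) N by (simp add: C_def \<sigma>_def \<rho>_def)
    have "finite (\<Gamma> - {1}) \<and> card (\<Gamma> - {1}) \<le> nat \<lfloor>C\<rfloor> + 1"
    proof (rule card_separated_le[OF \<sigma>])
      show "0 \<le> C" using C by simp
      show "\<Gamma> - {1} \<subseteq> {0..C * \<sigma>}"
        using gapE gap_le unfolding C\<sigma> by (force simp: \<Gamma>_def intro: less_imp_le)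
      fix x y assume xy: "x \<in> \<Gamma> - {1}" "y \<in> \<Gamma> - {1}" "x \<noteq> y"
      obtain k n where k: "x = (\<Sum>i\<in>UNIV. k i * \<alpha> $ i) + of_int n" "\<And>i. \<bar>real_of_int (k i)\<bar> \<le> 2 * b * T $ i"
        using gapE[OF xy(1)] by blast
      obtain l r where l: "y = (\<Sum>i\<in>UNIV. l i * \<alpha> $ i) + of_int r" "\<And>i. \<bar>real_of_int (l i)\<bar> \<le> 2 * b * T $ i"
        using gapE[OF xy(2)] by blast
      define p where "p i = k i - l i" for i
      have xy': "x - y = (\<Sum>i\<in>UNIV. p i * \<alpha> $ i) + of_int (n - r)"
        by (simp add: k(1) l(1) p_def left_diff_distrib sum_subtractf)
      \<comment> \<open>With \<open>p = 0\<close> the difference would be an integer; both lengths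
        lie strictly between 0 and 1, so it would vanish.\<close>
      have "\<exists>i. p i \<noteq> 0"
      proof (rule ccontr)
        assume "\<nexists>i. p i \<noteq> 0"
        then have "x - y = of_int (n - r)" using xy' by simp
        moreover have "\<bar>x - y\<bar> < 1" using gapE[OF xy(1)] gapE[OF xy(2)] by linarith
        ultimately have "n - r = 0" by linarith
        then show False using \<open>x - y = of_int (n - r)\<close> xy(3) by simp
      qed
      then have "c \<le> \<bar>x - y\<bar> * (\<Prod>i\<in>UNIV. max 1 \<bar>real_of_int (p i)\<bar>)"
        unfolding xy' by (rule c(2))
      also have "\<dots> \<le> \<bar>x - y\<bar> * (\<Prod>i\<in>UNIV. 4 * b * T $ i)"
      proof (intro mult_left_mono prod_mono conjI)
        fix i
        have "1 * 1 \<le> b * T $ i" using b(1) T1[of i] by (intro mult_mono) auto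
        then show "max 1 \<bar>real_of_int (p i)\<bar> \<le> 4 * b * T $ i"
          using k(2)[of i] l(2)[of i] unfolding p_def of_int_diff by linarith
      qed auto
      also have "(\<Prod>i\<in>UNIV. 4 * b * T $ i) = (4 * b) ^ d * N"
        by (simp add: prod.distrib N_def d_def power_mult_distrib)
      finally show "\<sigma> \<le> \<bar>x - y\<bar>"
        unfolding \<sigma>_def using b(1) N by (simp add: pos_divide_le_eq)
    qed
    \<comment> \<open>One more is added for the length 1 set aside before.\<close>
    then have "card \<Gamma> \<le> nat \<lfloor>C\<rfloor> + 2"
      using card_Diff_singleton_if[of \<Gamma> 1] by (auto split: if_splits)
    then show "G \<alpha> (scaleT T D) \<le> nat \<lfloor>C\<rfloor> + 2"
      by (simp add: G_def num_gaps_def \<Gamma>_def S_def X_def)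
  qed
qed

theorem theorem1p3:
  fixes D :: "(real ^ 'n) set" and \<alpha> :: "real ^ 'n" and \<epsilon> :: real
  assumes "CARD('n) \<ge> 2"
    and "bounded D" and "convex D"
    and "\<epsilon> > 0" and "{x. \<forall>i. 0 \<le> x $ i \<and> x $ i < \<epsilon>} \<subseteq> D"
    and "\<forall>N::nat. \<exists>T. (\<forall>i. T $ i \<ge> 1) \<and> G \<alpha> (scaleT T D) > N"
  shows "liminf (\<lambda>n::nat. ereal (real n * (\<Prod>i\<in>UNIV. dist_Z (real n * \<alpha> $ i)))) = 0"
proof (rule ccontr)
  assume "\<not> ?thesis"
  then obtain c where "c > 0"
    "\<And>q::nat. q \<ge> 1 \<Longrightarrow> c \<le> real q * (\<Prod>i\<in>UNIV. dist_Z (real q * \<alpha> $ i))"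
    using liminf_pos_imp_bounded_below[of "\<lambda>i. \<alpha> $ i"] by blast
  then obtain c' where c': "c' > 0" "\<And>(k::'n \<Rightarrow> int) (n::int). (\<exists>i. k i \<noteq> 0) \<Longrightarrow>
     c' \<le> \<bar>(\<Sum>i\<in>UNIV. k i * \<alpha> $ i) + n\<bar> * (\<Prod>i\<in>UNIV. max 1 \<bar>real_of_int (k i)\<bar>)"
    using transference[of c "\<lambda>i. \<alpha> $ i"] by blast
  obtain K where K: "\<forall>T. (\<forall>i. T $ i \<ge> 1) \<longrightarrow> G \<alpha> (scaleT T D) \<le> K"
    using G_bounded[OF c' assms(2,4,5)] by blast
  then show False using assms(6) by (metis not_le)
qed

end
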